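(* Let $k$ be a field of characteristic zero and let $A$ be any standard graded artinian $k$-algebra of codimension $3$ whose $h$-vector begins with $(1,3,4,5,\dots)$, i.e. $h_0=1$, $h_1=3$, $h_2=4$, $h_3=5$. Let $e$ be the multiplicity of $A$ and, for $i=1,2,3$, let $m_i$ be the smallest shift appearing in the $i$-th module $F_i$ of the minimal free resolution of $A$. Then $$\frac{m_1m_2m_3}{6}\le e .$$
   Context: $k$ is a field of characteristic zero, $R=k[x_1,x_2,x_3]$ with all $x_i$ of degree $1$, and $A=R/I$ is artinian with $I$ a homogeneous ideal containing no nonzero form of degree $1$. The $h$-vector of $A$ is $h(A)=(h_0,h_1,\dots,h_c)$, $h_i=\dim_k A_i$, where $c$ is the last index with $A_c\ne0$; the codimension is $h_1=3$ and the multiplicity is $e=h_0+\dots+h_c=\dim_k A$. The graded minimal free resolution of $A$ over $R$ is $0\to F_3\to F_2\to F_1\to R\to R/I\to 0$ with $F_i=\bigoplus_j R^{\beta_{i,j}}(-j)$; the shifts appearing in $F_i$ are the integers $j$ with $\beta_{i,j}>0$. *)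

theory Defs
  imports
    "HOL-Algebra.Algebra"
    "HOL-Algebra.Algebraic_Closure_Type"
    "HOL-Library.Poly_Mapping"
    "HOL-Library.Numeral_Type"
    "Jordan_Normal_Form.Matrix_Kernel"
begin

text \<open>
  The polynomial ring \<open>k[x\<^sub>1,x\<^sub>2,x\<^sub>3]\<close>: finitely supported functions from exponent vectors,
  indexed by the three-element type \<open>3\<close>, to coefficients.
\<close>

type_synonym 'k poly3 = "(3 \<Rightarrow>\<^sub>0 nat) \<Rightarrow>\<^sub>0 'k"

abbreviation R3 :: "'k::field poly3 ring"
  where "R3 \<equiv> ring_of_type_algebra"

definition mon_degree :: "(3 \<Rightarrow>\<^sub>0 nat) \<Rightarrow> nat"
  where "mon_degree m = (\<Sum>i\<in>UNIV. Poly_Mapping.lookup m i)"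

text \<open>
  The graded piece of degree \<open>d\<close>, zero included. Degrees are integers so that differences of
  shifts make sense; for \<open>d < 0\<close> the piece is \<open>0\<close>.
\<close>

definition forms :: "int \<Rightarrow> 'k::field poly3 set"
  where "forms d = {p. \<forall>m\<in>Poly_Mapping.keys p. int (mon_degree m) = d}"

definition homogeneous_ideal :: "'k::field poly3 set \<Rightarrow> bool"
  where "homogeneous_ideal I \<longleftrightarrow>
    ideal I R3 \<and> (\<exists>S \<subseteq> (\<Union>d. forms d). I = genideal R3 S)"

definition artinian_ring :: "('a, 'b) ring_scheme \<Rightarrow> bool"
  where "artinian_ring A \<longleftrightarrow>
    cring A \<and>
    (\<forall>J :: nat \<Rightarrow> 'a set. (\<forall>n. ideal (J n) A) \<and> (\<forall>n. J (Suc n) \<subseteq> J n)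
      \<longrightarrow> (\<exists>N. \<forall>n\<ge>N. J n = J N))"

text \<open>The quotient \<open>A = R/I\<close>: the copy of \<open>k\<close> in it, its graded pieces and its dimensions over \<open>k\<close>.\<close>

definition scalars :: "'k::field poly3 set \<Rightarrow> 'k poly3 set set"
  where "scalars I = range (\<lambda>c. I +>\<^bsub>R3\<^esub> Poly_Mapping.single 0 c)"

definition quot_piece :: "'k::field poly3 set \<Rightarrow> nat \<Rightarrow> 'k poly3 set set"
  where "quot_piece I i = (\<lambda>p. I +>\<^bsub>R3\<^esub> p) ` forms (int i)"

definition h_vector :: "'k::field poly3 set \<Rightarrow> nat \<Rightarrow> nat"
  where "h_vector I i = ring.dim (R3 Quot I) (scalars I) (quot_piece I i)"

definition multiplicity_quot :: "'k::field poly3 set \<Rightarrow> nat"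
  where "multiplicity_quot I = ring.dim (R3 Quot I) (scalars I) (carrier (R3 Quot I))"

text \<open>
  A list \<open>s\<close> of integers stands for the graded free module \<open>\<Oplus>\<^sub>b R(-s\<^sub>b)\<close>, so the multiplicity of
  \<open>j\<close> in \<open>s\<close> is the graded Betti number and \<open>set s\<close> is the set of shifts that appear. Elements are
  column vectors of polynomials. A matrix represents a homomorphism of degree \<open>0\<close> from
  \<open>\<Oplus>\<^sub>b R(-s\<^sub>b)\<close> to \<open>\<Oplus>\<^sub>a R(-t\<^sub>a)\<close> iff its \<open>(a,b)\<close> entry is a form of degree \<open>s\<^sub>b - t\<^sub>a\<close>.
\<close>

definition graded_map :: "int list \<Rightarrow> int list \<Rightarrow> 'k::field poly3 mat \<Rightarrow> bool"
  where "graded_map s t M \<longleftrightarrow>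
    M \<in> carrier_mat (length t) (length s) \<and>
    (\<forall>a < length t. \<forall>b < length s. M $$ (a, b) \<in> forms (s ! b - t ! a))"

definition mat_image :: "'k::field poly3 mat \<Rightarrow> 'k poly3 vec set"
  where "mat_image M = (\<lambda>v. M *\<^sub>v v) ` carrier_vec (dim_col M)"

text \<open>
  The module \<open>\<mm>R\<^sup>n\<close> for \<open>\<mm> = (x\<^sub>1,x\<^sub>2,x\<^sub>3)\<close>, which consists of the polynomials without constant term.
\<close>

definition max_times_free :: "nat \<Rightarrow> 'k::field poly3 vec set"
  where "max_times_free n = {v \<in> carrier_vec n. \<forall>i<n. Poly_Mapping.lookup (v $ i) 0 = 0}"

text \<open>
  \<open>0 \<rightarrow> F\<^sub>3 \<rightarrow> F\<^sub>2 \<rightarrow> F\<^sub>1 \<rightarrow> R \<rightarrow> R/I \<rightarrow> 0\<close> with \<open>F\<^sub>i\<close> given by the shifts \<open>s\<^sub>i\<close>. Exactness at \<open>R\<close>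
  says that the image of \<open>M1\<close> is \<open>I\<close>, viewed in the rank one module \<open>R\<close> (whose shift is \<open>0\<close>).
  Minimality: each map \<open>F\<^sub>i \<rightarrow> F\<^sub>i\<^sub>-\<^sub>1\<close> has image in \<open>\<mm>F\<^sub>i\<^sub>-\<^sub>1\<close>.
\<close>

definition minimal_graded_free_resolution ::
  "'k::field poly3 set \<Rightarrow> int list \<Rightarrow> int list \<Rightarrow> int list \<Rightarrow>
   'k poly3 mat \<Rightarrow> 'k poly3 mat \<Rightarrow> 'k poly3 mat \<Rightarrow> bool"
  where "minimal_graded_free_resolution I s1 s2 s3 M1 M2 M3 \<longleftrightarrow>
    graded_map s1 [0] M1 \<and> graded_map s2 s1 M2 \<and> graded_map s3 s2 M3 \<and>
    mat_image M1 = {v \<in> carrier_vec 1. v $ 0 \<in> I} \<and>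
    mat_image M2 = mat_kernel M1 \<and>
    mat_image M3 = mat_kernel M2 \<and>
    mat_kernel M3 = {0\<^sub>v (length s3)} \<and>
    mat_image M1 \<subseteq> max_times_free 1 \<and>
    mat_image M2 \<subseteq> max_times_free (length s1) \<and>
    mat_image M3 \<subseteq> max_times_free (length s2)"

definition min_shift :: "int list \<Rightarrow> int"
  where "min_shift s = Min (set s)"

end

(*
  Let c be such that A_c is nonzero and A_(c+1) = 0. Then e >= 1 + 3 + (c - 1) = c + 3, and the
  claim follows from m_1 = 2, m_2 <= 3 and m_3 <= c + 3.
  Since h_2 = 4 and h_3 = 5, the space I_2 has a basis f, g of two quadrics, while I_3 has
  dimension 5 and hence contains a linear relation between the six products x_i f, x_i g. This
  linear syzygy of two generators of I forces a shift at most 3 in F_2. The forms of degree c are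
  socle elements of A, and their Koszul classes give a shift at most c + 3 in F_3.
*)
theory Submission
  imports Defs
begin

text \<open>The divisor 6 is 2 * 3, the product of the bounds for \<open>m_1\<close> and
  \<open>m_2\<close>; with these the claim reduces to \<open>m_3\<close> being at most
  \<open>c + 3\<close>. Both upper bounds on shifts are proved inside the given resolution by
  homogeneous lifting. An element of degree \<open>d\<close> lifts to a vector whose entry
  \<open>b\<close> has degree \<open>d - s ! b\<close>. If all shifts exceed \<open>d\<close>, these
  degrees are negative and the lift is 0. So the absence of a small shift turns a relation modulo
  boundaries into an identity in a free module, and cancelling there contradicts
  \<open>f \<notin> I\<close> in one case and the independence of the two quadrics in the other. One
  obstacle is that \<open>f\<close> and \<open>g\<close> need not be columns of \<open>M1\<close>.
  They are replaced by lifts \<open>u\<close> and \<open>v\<close> to \<open>F_1\<close>; the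
  generators of \<open>I\<close> have degree at least 2, so the entries of these lifts are
  constants, and the independence of \<open>f\<close> and \<open>g\<close> over \<open>k\<close> can
  be applied to them. Minimality acts in the opposite direction and bounds shifts from below. This
  gives \<open>m_1 = 2\<close> exactly, and it makes \<open>m_1 m_2\<close> nonnegative, so that the
  bound for \<open>m_3\<close> may be multiplied by it.\<close>

no_notation fps_nth (infixl "$" 75)

section \<open>Truncations of polynomials: homogeneous components, degree cut-offs and remainders
  modulo a variable\<close>

lift_definition restr :: "('a \<Rightarrow> bool) \<Rightarrow> ('a \<Rightarrow>\<^sub>0 'b) \<Rightarrow> 'a \<Rightarrow>\<^sub>0 'b::zero"
  is "\<lambda>P f m. if P m then f m else 0"
  by (erule rev_finite_subset) (auto split: if_splits)

lemma lookup_restr: "Poly_Mapping.lookup (restr P p) m = (if P m then Poly_Mapping.lookup p m else 0)"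
  by transfer simp

lemma keys_restr: "Poly_Mapping.keys (restr P p) = {m \<in> Poly_Mapping.keys p. P m}"
  by (auto simp: in_keys_iff lookup_restr split: if_splits)

lemma keys_multE:
  assumes "m \<in> Poly_Mapping.keys (f * g)"
  obtains a b where "a \<in> Poly_Mapping.keys f" "b \<in> Poly_Mapping.keys g" "m = a + b"
  using assms keys_mult by blast

lemma restr_zero [simp]: "restr P 0 = 0"
  by (rule poly_mapping_eqI) (simp add: lookup_restr)

lemma restr_add: "restr P (p + q) = restr P p + restr P (q :: 'a \<Rightarrow>\<^sub>0 'b::monoid_add)"
  by (rule poly_mapping_eqI) (simp add: lookup_restr lookup_add)

lemma restr_diff: "restr P (p - q) = restr P p - restr P (q :: 'a \<Rightarrow>\<^sub>0 'b::ab_group_add)"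
  by (rule poly_mapping_eqI) (simp add: lookup_restr lookup_minus)

lemma restr_sum: "restr P (sum f A) = (\<Sum>a\<in>A. restr P (f a :: 'a \<Rightarrow>\<^sub>0 'b::comm_monoid_add))"
  by (induction A rule: infinite_finite_induct) (simp_all add: restr_add)

lemma restr_id: "(\<And>m. m \<in> Poly_Mapping.keys p \<Longrightarrow> P m) \<Longrightarrow> restr P p = p"
  by (rule poly_mapping_eqI) (auto simp: lookup_restr in_keys_iff)

lemma restr_eq_0: "(\<And>m. m \<in> Poly_Mapping.keys p \<Longrightarrow> \<not> P m) \<Longrightarrow> restr P p = 0"
  by (rule poly_mapping_eqI) (auto simp: lookup_restr in_keys_iff)

lemma restr_split: "restr P p + restr (\<lambda>m. \<not> P m) p = (p :: 'a \<Rightarrow>\<^sub>0 'b::monoid_add)"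
  by (rule poly_mapping_eqI) (simp add: lookup_restr lookup_add)

lemma mon_degree_add: "mon_degree (m + n) = mon_degree m + mon_degree n"
  by (simp add: mon_degree_def lookup_add sum.distrib)

lemma mon_degree_zero [simp]: "mon_degree 0 = 0"
  by (simp add: mon_degree_def)

lemma mon_degree_eq_0_iff: "mon_degree m = 0 \<longleftrightarrow> m = 0"
  by (auto simp: mon_degree_def intro: poly_mapping_eqI)

lemma mon_degree_single [simp]: "mon_degree (Poly_Mapping.single i n) = n"
  by (simp add: mon_degree_def lookup_single when_def)

abbreviation hcomp :: "int \<Rightarrow> 'k::field poly3 \<Rightarrow> 'k poly3"
  where "hcomp d \<equiv> restr (\<lambda>m. int (mon_degree m) = d)"

lemma hcomp_in_forms: "hcomp d p \<in> forms d"
  by (auto simp: forms_def keys_restr)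

lemma zero_in_forms [simp]: "0 \<in> forms d"
  by (simp add: forms_def)

lemma forms_add: "p \<in> forms d \<Longrightarrow> q \<in> forms d \<Longrightarrow> p + q \<in> forms d"
  using keys_add[of p q] by (auto simp: forms_def)

lemma forms_uminus: "p \<in> forms d \<Longrightarrow> - p \<in> forms d"
  by (auto simp: forms_def in_keys_iff)

lemma forms_diff: "p \<in> forms d \<Longrightarrow> q \<in> forms d \<Longrightarrow> p - q \<in> forms d"
  using forms_add[OF _ forms_uminus] by (metis diff_conv_add_uminus)

lemma forms_mult: "p \<in> forms d \<Longrightarrow> q \<in> forms e \<Longrightarrow> p * q \<in> forms (d + e)"
  by (auto simp: forms_def mon_degree_add elim!: keys_multE)

lemma forms_neg: "p \<in> forms d \<Longrightarrow> d < 0 \<Longrightarrow> p = 0"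
  by (rule poly_mapping_eqI) (force simp: forms_def in_keys_iff)

lemma forms_single: "int (mon_degree m) = d \<Longrightarrow> Poly_Mapping.single m a \<in> forms d"
  by (simp add: forms_def)

lemma hcomp_form: "p \<in> forms d \<Longrightarrow> hcomp d p = p"
  by (rule restr_id) (auto simp: forms_def)

lemma hcomp_form_other: "p \<in> forms e \<Longrightarrow> d \<noteq> e \<Longrightarrow> hcomp d p = 0"
  by (rule restr_eq_0) (auto simp: forms_def)

text \<open>The part of \<open>p\<close> outside degree \<open>e\<close>, multiplied by a form of
  degree \<open>d\<close>, has no monomial of degree \<open>d + e\<close>. Hence graded matrices
  commute with taking components of matching degrees.\<close>

lemma hcomp_mult_form:
  assumes "f \<in> forms d"
  shows "hcomp (d + e) (f * p) = f * hcomp e p"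
proof -
  let ?q = "restr (\<lambda>m. int (mon_degree m) \<noteq> e) p"
  have "f * p = f * hcomp e p + f * ?q"
    by (simp only: distrib_left[symmetric] restr_split)
  moreover have "hcomp (d + e) (f * hcomp e p) = f * hcomp e p"
    by (intro hcomp_form forms_mult assms hcomp_in_forms)
  moreover have "hcomp (d + e) (f * ?q) = 0"
    using assms
    by (intro restr_eq_0) (auto simp: forms_def mon_degree_add keys_restr elim!: keys_multE)
  ultimately show ?thesis by (simp add: restr_add)
qed

section \<open>Division by a variable and exactness of the Koszul complex\<close>

definition indet :: "3 \<Rightarrow> 'k::field poly3"
  where "indet i = Poly_Mapping.single (Poly_Mapping.single i 1) 1"

lemma indet_in_forms: "indet i \<in> forms 1"
  by (simp add: indet_def forms_single)

lemma poly_sum_singles: "p = (\<Sum>m\<in>Poly_Mapping.keys p. Poly_Mapping.single m (Poly_Mapping.lookup p m))"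
  by (rule poly_mapping_eqI)
    (auto simp: lookup_sum lookup_single when_def in_keys_iff)

lemma indet_dvd:
  assumes "\<And>m. m \<in> Poly_Mapping.keys p \<Longrightarrow> Poly_Mapping.lookup m i \<noteq> 0"
  shows "\<exists>q. p = indet i * (q :: 'k::field poly3)"
proof -
  let ?x = "Poly_Mapping.single i (1::nat)"
  have split: "m = ?x + (m - ?x)" if "m \<in> Poly_Mapping.keys p" for m
    using assms[OF that]
    by (intro poly_mapping_eqI) (auto simp: lookup_add lookup_minus lookup_single when_def)
  have "p = (\<Sum>m\<in>Poly_Mapping.keys p. Poly_Mapping.single m (Poly_Mapping.lookup p m))"
    by (rule poly_sum_singles)
  also have "\<dots> = (\<Sum>m\<in>Poly_Mapping.keys p. indet i * Poly_Mapping.single (m - ?x) (Poly_Mapping.lookup p m))"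
    by (rule sum.cong) (simp_all only: indet_def mult_single mult_1_left split[symmetric])
  also have "\<dots> = indet i * (\<Sum>m\<in>Poly_Mapping.keys p. Poly_Mapping.single (m - ?x) (Poly_Mapping.lookup p m))"
    by (rule sum_distrib_left[symmetric])
  finally show ?thesis ..
qed

text \<open>The truncation to monomials free of the variable is the remainder of division by it, so
  \<open>restr\<close> here plays the role of reduction modulo \<open>indet i\<close>.\<close>

lemma division_by_indet:
  obtains q where "p = restr (\<lambda>m. Poly_Mapping.lookup m i = 0) p + indet i * (q :: 'k::field poly3)"
proof -
  obtain q where q: "restr (\<lambda>m. Poly_Mapping.lookup m i \<noteq> 0) p = indet i * q"
    using indet_dvd[of "restr (\<lambda>m. Poly_Mapping.lookup m i \<noteq> 0) p" i] by (auto simp: keys_restr)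
  show thesis
    by (rule that[of q]) (simp only: q[symmetric] restr_split)
qed

lemma restr_indet_mult: "restr (\<lambda>m. Poly_Mapping.lookup m i = 0) (indet i * q) = 0"
  by (intro restr_eq_0) (auto simp: indet_def lookup_add elim!: keys_multE)

lemma restr_indet_mult_other:
  assumes "i \<noteq> j"
  shows "restr (\<lambda>m. Poly_Mapping.lookup m i = 0) (indet j * q)
    = indet j * restr (\<lambda>m. Poly_Mapping.lookup m i = 0) q"
proof -
  let ?P = "\<lambda>m :: 3 \<Rightarrow>\<^sub>0 nat. Poly_Mapping.lookup m i = 0"
  obtain r where r: "q = restr ?P q + indet i * r" by (rule division_by_indet)
  have *: "restr ?P (indet j * restr ?P q) = indet j * restr ?P q"
    using assms
    by (intro restr_id) (auto simp: indet_def lookup_add keys_restr lookup_single when_def elim!: keys_multE)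
  have "indet j * q = indet j * restr ?P q + indet i * (indet j * r)"
    using arg_cong[OF r, of "(*) (indet j)"] by (simp only: distrib_left mult.left_commute[of "indet i"])
  then show ?thesis by (simp add: restr_add * restr_indet_mult)
qed

lemma indet_nonzero [simp]: "(indet i :: 'k::field poly3) \<noteq> 0"
proof
  assume "indet i = (0 :: 'k poly3)"
  then have "Poly_Mapping.lookup (indet i :: 'k poly3) (Poly_Mapping.single i 1) = 0" by simp
  then show False by (simp add: indet_def)
qed

text \<open>Reduction modulo \<open>indet j\<close> kills the right-hand side and commutes with
  \<open>indet i\<close>, so the remainder of \<open>p\<close> is 0. Cancelling
  \<open>indet j\<close> then gives \<open>q\<close>.\<close>

lemma koszul2:
  assumes "i \<noteq> j" and "indet i * p = indet j * (q :: 'k::field poly3)"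
  shows "\<exists>g. p = indet j * g \<and> q = indet i * g"
proof -
  let ?P = "\<lambda>m :: 3 \<Rightarrow>\<^sub>0 nat. Poly_Mapping.lookup m j = 0"
  obtain g where g: "p = restr ?P p + indet j * g" by (rule division_by_indet)
  have "indet i * restr ?P p = restr ?P (indet j * q)"
    using restr_indet_mult_other[of j i p] assms by simp
  then have "p = indet j * g"
    using g by (simp add: restr_indet_mult)
  moreover from this assms have "indet j * (indet i * g) = indet j * q"
    by (simp add: mult.left_commute)
  ultimately show ?thesis by simp
qed

text \<open>Reduction modulo \<open>indet l\<close> removes the third summand and leaves the case of
  two variables for the remainders, which yields \<open>c\<close>. The quotients of the two
  divisions are \<open>b\<close> and \<open>a\<close>, and \<open>r\<close> follows by cancelling
  \<open>indet l\<close>.\<close>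

lemma koszul3:
  fixes p q r :: "'k::field poly3"
  assumes "i \<noteq> j" "i \<noteq> l" "j \<noteq> l" and eq: "indet i * p + indet j * q + indet l * r = 0"
  shows "\<exists>a b c. p = indet j * c + indet l * b \<and> q = indet l * a - indet i * c \<and> r = - (indet i * b) - indet j * a"
proof -
  let ?P = "\<lambda>m :: 3 \<Rightarrow>\<^sub>0 nat. Poly_Mapping.lookup m l = 0"
  obtain b where b: "p = restr ?P p + indet l * b" by (rule division_by_indet)
  obtain a where a: "q = restr ?P q + indet l * a" by (rule division_by_indet)
  have "restr ?P (indet i * p + indet j * q + indet l * r) = 0" by (simp add: eq)
  then have "indet i * restr ?P p = indet j * (- restr ?P q)"
    using assms(1-3)
    by (simp add: restr_add restr_indet_mult restr_indet_mult_other eq_neg_iff_add_eq_0)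
  from koszul2[OF \<open>i \<noteq> j\<close> this] obtain c
    where c: "restr ?P p = indet j * c" "restr ?P q = - (indet i * c)"
    by (metis minus_minus)
  have p: "p = indet j * c + indet l * b" and q: "q = indet l * a - indet i * c"
    using a b unfolding c by simp_all
  have "indet l * (r + indet i * b + indet j * a) = 0"
    using eq unfolding p q by (simp add: algebra_simps)
  then have "r + indet i * b + indet j * a = 0" by simp
  then have "r = - (indet i * b) - indet j * a" by (simp add: algebra_simps eq_neg_iff_add_eq_0)
  with p q show ?thesis by blast
qed

section \<open>Homogeneous lifting through the resolution, and the shift coming from the
  socle\<close>

lemma graded_map_carrier: "graded_map s t M \<Longrightarrow> M \<in> carrier_mat (length t) (length s)"
  by (simp add: graded_map_def)

lemma mult_mat_vec_index_sum:
  "a < dim_row M \<Longrightarrow> dim_vec v = dim_col M \<Longrightarrow> (M *\<^sub>v v) $ a = (\<Sum>b<dim_col M. M $$ (a, b) * v $ b)"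
  by (simp add: scalar_prod_def lessThan_atLeast0)

text \<open>Any preimage can be made homogeneous: keep in coordinate \<open>b\<close> only the
  component of degree \<open>d - s ! b\<close>. The discarded components contribute nothing in the
  degrees where \<open>v\<close> lives.\<close>

lemma graded_lift:
  assumes M: "graded_map s t M" and "v \<in> mat_image M"
    and v: "\<And>a. a < length t \<Longrightarrow> v $ a \<in> forms (d - t ! a)"
  obtains w where "w \<in> carrier_vec (length s)" "v = M *\<^sub>v w"
    "\<And>b. b < length s \<Longrightarrow> w $ b \<in> forms (d - s ! b)"
proof -
  note C = graded_map_carrier[OF M]
  from assms(2) C obtain w where w: "w \<in> carrier_vec (length s)" "v = M *\<^sub>v w"
    by (auto simp: mat_image_def)
  let ?w = "vec (length s) (\<lambda>b. hcomp (d - s ! b) (w $ b))"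
  have "v = M *\<^sub>v ?w"
  proof (rule eq_vecI)
    fix a assume "a < dim_vec (M *\<^sub>v ?w)"
    with C have a: "a < length t" by simp
    have "v $ a = hcomp (d - t ! a) (v $ a)" using v[OF a] by (simp add: hcomp_form)
    also have "\<dots> = hcomp (d - t ! a) (\<Sum>b<length s. M $$ (a, b) * w $ b)"
      using mult_mat_vec_index_sum[of a M w] w C a by auto
    also have "\<dots> = (\<Sum>b<length s. M $$ (a, b) * hcomp (d - s ! b) (w $ b))"
      unfolding restr_sum
    proof (rule sum.cong)
      fix b assume "b \<in> {..<length s}"
      with M a have "M $$ (a, b) \<in> forms (s ! b - t ! a)" by (auto simp: graded_map_def)
      from hcomp_mult_form[OF this, of "d - s ! b" "w $ b"]
      show "hcomp (d - t ! a) (M $$ (a, b) * w $ b) = M $$ (a, b) * hcomp (d - s ! b) (w $ b)"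
        by simp
    qed simp
    also have "\<dots> = (M *\<^sub>v ?w) $ a"
      using mult_mat_vec_index_sum[of a M ?w] C a by auto
    finally show "v $ a = (M *\<^sub>v ?w) $ a" .
  qed (use w C in auto)
  then show thesis by (intro that[of ?w]) (auto simp: hcomp_in_forms)
qed

lemma koszul_vec:
  fixes p q r :: "'k::field poly3 vec"
  assumes "i \<noteq> j" "i \<noteq> l" "j \<noteq> l"
    and dims: "p \<in> carrier_vec n" "q \<in> carrier_vec n" "r \<in> carrier_vec n"
    and eq: "indet i \<cdot>\<^sub>v p + indet j \<cdot>\<^sub>v q + indet l \<cdot>\<^sub>v r = 0\<^sub>v n"
  shows "\<exists>a b c. a \<in> carrier_vec n \<and> b \<in> carrier_vec n \<and> c \<in> carrier_vec n \<and>
    p = indet j \<cdot>\<^sub>v c + indet l \<cdot>\<^sub>v b \<and> q = indet l \<cdot>\<^sub>v a - indet i \<cdot>\<^sub>v c \<and>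
    r = - (indet i \<cdot>\<^sub>v b) - indet j \<cdot>\<^sub>v a"
proof -
  have "\<exists>a b c. p $ k = indet j * c + indet l * b \<and> q $ k = indet l * a - indet i * c \<and>
      r $ k = - (indet i * b) - indet j * a" if "k < n" for k
  proof (rule koszul3[OF assms(1-3)])
    have "(indet i \<cdot>\<^sub>v p + indet j \<cdot>\<^sub>v q + indet l \<cdot>\<^sub>v r) $ k = 0"
      using that by (simp add: eq)
    then show "indet i * p $ k + indet j * q $ k + indet l * r $ k = 0"
      using that dims by (simp add: add.assoc)
  qed
  then obtain a b c where
    "\<And>k. k < n \<Longrightarrow> p $ k = indet j * c k + indet l * b k \<and> q $ k = indet l * a k - indet i * c k \<and>
      r $ k = - (indet i * b k) - indet j * a k"
    by metis
  then show ?thesis using dims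
    by (intro exI[of _ "vec n a"] exI[of _ "vec n b"] exI[of _ "vec n c"]) (auto intro!: eq_vecI)
qed

lemma mult_mat_vec_smult:
  fixes A :: "'a::comm_ring mat"
  assumes "A \<in> carrier_mat nr nc" "v \<in> carrier_vec nc"
  shows "A *\<^sub>v (k \<cdot>\<^sub>v v) = k \<cdot>\<^sub>v (A *\<^sub>v v)"
  using assms by (intro eq_vecI) (auto simp: scalar_prod_def sum_distrib_left mult.left_commute)

lemma mult_mat_vec_uminus:
  fixes A :: "'a::comm_ring mat"
  assumes "A \<in> carrier_mat nr nc" "v \<in> carrier_vec nc"
  shows "A *\<^sub>v (- v) = - (A *\<^sub>v v)"
  using assms by (intro eq_vecI) (auto simp: scalar_prod_def sum_negf)

lemma mult_mat_vec_zero: "A \<in> carrier_mat nr nc \<Longrightarrow> A *\<^sub>v 0\<^sub>v nc = 0\<^sub>v nr"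
  for A :: "'a::semiring_0 mat"
  by (intro eq_vecI) (auto simp: scalar_prod_def)

lemma mat_kernel_iff: "v \<in> mat_kernel M \<longleftrightarrow> v \<in> carrier_vec (dim_col M) \<and> M *\<^sub>v v = 0\<^sub>v (dim_row M)"
  by (auto simp: mat_kernel_def)

lemma graded_lift_kernel:
  assumes "graded_map s t M" "graded_map r s N" "mat_image N = mat_kernel M"
    and "v \<in> carrier_vec (length s)" "M *\<^sub>v v = 0\<^sub>v (length t)"
    and "\<And>a. a < length s \<Longrightarrow> v $ a \<in> forms (d - s ! a)"
  obtains w where "w \<in> carrier_vec (length r)" "v = N *\<^sub>v w"
    "\<And>b. b < length r \<Longrightarrow> w $ b \<in> forms (d - r ! b)"
proof (rule graded_lift[OF assms(2) _ assms(6)])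
  show "v \<in> mat_image N"
    using assms graded_map_carrier[OF assms(1)] by (auto simp: mat_kernel_iff)
qed (use that in auto)

text \<open>
  A form \<open>f\<close> of degree \<open>c\<close> in the socle of \<open>R/I\<close> gives a nonzero class in
  \<open>Tor\<^sub>3(R/I, k)\<close> of degree \<open>c + 3\<close>: lift the cycle \<open>f\<close> of the Koszul complex on \<open>R/I\<close> through the
  resolution. If \<open>F\<^sub>3\<close> had no element of that degree, the exactness of the Koszul complex would
  let the lifting be reversed and give \<open>f \<in> I\<close>.
\<close>

lemma socle_shift:
  fixes f :: "'k::field poly3"
  assumes res: "minimal_graded_free_resolution I s1 s2 s3 M1 M2 M3"
    and f: "f \<in> forms d" "f \<notin> I" and socle: "\<And>i. indet i * f \<in> I"
  shows "\<exists>b < length s3. s3 ! b \<le> d + 3"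
proof (rule ccontr)
  assume neg: "\<not> ?thesis"
  note R = res[unfolded minimal_graded_free_resolution_def]
  have G: "graded_map s1 [0] M1" "graded_map s2 s1 M2" "graded_map s3 s2 M3"
    and ex: "mat_image M2 = mat_kernel M1" "mat_image M3 = mat_kernel M2"
    and im: "mat_image M1 = {v \<in> carrier_vec 1. v $ 0 \<in> I}"
    using R by auto
  note C = G[THEN graded_map_carrier]
  have C1: "M1 \<in> carrier_mat (Suc 0) (length s1)" using C by simp
  define fv where "fv = vec 1 (\<lambda>_. f)"
  have fv: "fv \<in> carrier_vec 1" by (simp add: fv_def)
  have "\<exists>u. u \<in> carrier_vec (length s1) \<and> indet i \<cdot>\<^sub>v fv = M1 *\<^sub>v u \<and>
      (\<forall>a < length s1. u $ a \<in> forms (d + 1 - s1 ! a))" for i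
  proof (rule graded_lift[OF G(1), of "indet i \<cdot>\<^sub>v fv" "d + 1"])
    show "indet i \<cdot>\<^sub>v fv \<in> mat_image M1" using socle by (simp add: im fv_def)
    show "(indet i \<cdot>\<^sub>v fv) $ a \<in> forms (d + 1 - [0] ! a)" if "a < length [0::int]" for a
      using that forms_mult[OF indet_in_forms[of i] f(1)] by (simp add: fv_def add.commute)
  qed auto
  then obtain u where u: "\<And>i. u i \<in> carrier_vec (length s1)" "\<And>i. indet i \<cdot>\<^sub>v fv = M1 *\<^sub>v u i"
    "\<And>i a. a < length s1 \<Longrightarrow> u i $ a \<in> forms (d + 1 - s1 ! a)"
    by metis
  \<comment> \<open>The commutation \<open>x_i (x_j f) = x_j (x_i f)\<close> makes this combination
    of the lifts \<open>u i\<close> a cycle in \<open>F_1\<close>.\<close>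
  have "\<exists>w. w \<in> carrier_vec (length s2) \<and> indet i \<cdot>\<^sub>v u j - indet j \<cdot>\<^sub>v u i = M2 *\<^sub>v w \<and>
      (\<forall>a < length s2. w $ a \<in> forms (d + 2 - s2 ! a))" for i j
  proof (rule graded_lift_kernel[OF G(1,2) ex(1), of "indet i \<cdot>\<^sub>v u j - indet j \<cdot>\<^sub>v u i" "d + 2"])
    have "M1 *\<^sub>v (indet i \<cdot>\<^sub>v u j - indet j \<cdot>\<^sub>v u i) = indet i \<cdot>\<^sub>v (M1 *\<^sub>v u j) - indet j \<cdot>\<^sub>v (M1 *\<^sub>v u i)"
      using u(1) C1 by (simp add: mult_minus_distrib_mat_vec[OF C1] mult_mat_vec_smult[OF C1])
    also have "\<dots> = 0\<^sub>v 1"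
      unfolding u(2)[symmetric] using fv by (auto simp: smult_smult_assoc mult.commute)
    finally show "M1 *\<^sub>v (indet i \<cdot>\<^sub>v u j - indet j \<cdot>\<^sub>v u i) = 0\<^sub>v (length [0])" by simp
    show "(indet i \<cdot>\<^sub>v u j - indet j \<cdot>\<^sub>v u i) $ a \<in> forms (d + 2 - s1 ! a)" if "a < length s1" for a
      using that u(1) forms_diff[OF forms_mult[OF indet_in_forms[of i] u(3)[of a j]]
          forms_mult[OF indet_in_forms[of j] u(3)[of a i]]]
      by (simp add: algebra_simps carrier_vecD[OF u(1)])
  qed (use u(1) in auto)
  then obtain w where w: "\<And>i j. w i j \<in> carrier_vec (length s2)"
    "\<And>i j. indet i \<cdot>\<^sub>v u j - indet j \<cdot>\<^sub>v u i = M2 *\<^sub>v w i j"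
    "\<And>i j a. a < length s2 \<Longrightarrow> w i j $ a \<in> forms (d + 2 - s2 ! a)"
    by metis
  \<comment> \<open>In this cyclic sum every product \<open>x_i x_j u_l\<close> occurs twice with
    opposite signs, so \<open>M2\<close> maps it to 0.\<close>
  let ?z = "indet 0 \<cdot>\<^sub>v w 1 2 + indet 1 \<cdot>\<^sub>v w 2 0 + indet 2 \<cdot>\<^sub>v w 0 1"
  have z: "?z \<in> carrier_vec (length s2)" using w(1) by simp
  have "M2 *\<^sub>v ?z = indet 0 \<cdot>\<^sub>v (M2 *\<^sub>v w 1 2) + indet 1 \<cdot>\<^sub>v (M2 *\<^sub>v w 2 0) + indet 2 \<cdot>\<^sub>v (M2 *\<^sub>v w 0 1)"
    using w(1) C(2) by (simp add: mult_add_distrib_mat_vec[OF C(2)]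
        mult_mat_vec_smult[OF C(2)])
  also have "\<dots> = 0\<^sub>v (length s1)"
    unfolding w(2)[symmetric] using carrier_vecD[OF u(1)] by (auto simp: algebra_simps)
  finally obtain y where y: "y \<in> carrier_vec (length s3)" "?z = M3 *\<^sub>v y"
    "\<And>b. b < length s3 \<Longrightarrow> y $ b \<in> forms (d + 3 - s3 ! b)"
  proof (rule graded_lift_kernel[OF G(2,3) ex(2) z, of "d + 3"])
    show "?z $ a \<in> forms (d + 3 - s2 ! a)" if "a < length s2" for a
      using that forms_add[OF forms_add[OF forms_mult[OF indet_in_forms[of 0] w(3)[of a 1 2]]
          forms_mult[OF indet_in_forms[of 1] w(3)[of a 2 0]]]
          forms_mult[OF indet_in_forms[of 2] w(3)[of a 0 1]]]
      by (simp add: algebra_simps carrier_vecD[OF w(1)])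
  qed auto
  \<comment> \<open>Every shift of \<open>F_3\<close> exceeds \<open>d + 3\<close> by assumption, so
    all entries of \<open>y\<close> have negative degree.\<close>
  have "y = 0\<^sub>v (length s3)"
    using y(1) neg forms_neg[OF y(3)] by (intro eq_vecI) (auto simp: not_le)
  then have "?z = 0\<^sub>v (length s2)" using y(2) C(3) by auto
  \<comment> \<open>The reversal of the lifting begins: the \<open>w i j\<close> now form an exact
    Koszul cycle and hence a Koszul boundary.\<close>
  from koszul_vec[OF _ _ _ w(1) w(1) w(1) this] obtain a b c where abc:
    "a \<in> carrier_vec (length s2)" "b \<in> carrier_vec (length s2)" "c \<in> carrier_vec (length s2)"
    "w 2 0 = indet 2 \<cdot>\<^sub>v a - indet 0 \<cdot>\<^sub>v c" "w 0 1 = - (indet 0 \<cdot>\<^sub>v b) - indet 1 \<cdot>\<^sub>v a"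
    by auto
  have M12: "M1 *\<^sub>v (M2 *\<^sub>v v) = 0\<^sub>v (Suc 0)" if "v \<in> carrier_vec (length s2)" for v
  proof -
    have "M2 *\<^sub>v v \<in> mat_kernel M1" using that C(2) unfolding ex(1)[symmetric] mat_image_def by auto
    then show ?thesis using C1 by (simp add: mat_kernel_iff)
  qed
  \<comment> \<open>The corrections are boundaries, so the images under \<open>M1\<close> stay
    \<open>x_0 f\<close> and \<open>x_1 f\<close>, but now \<open>x_0 u1 = x_1 u0\<close> holds
    exactly. By \<open>koszul2\<close>, \<open>u0\<close> is divisible by \<open>x_0\<close>, and
    dividing \<open>M1 u0 = x_0 f\<close> by \<open>x_0\<close> puts \<open>f\<close> into
    \<open>I\<close>.\<close>
  define u0 where "u0 = u 0 - M2 *\<^sub>v a"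
  define u1 where "u1 = u 1 + M2 *\<^sub>v b"
  have Ma: "M2 *\<^sub>v a \<in> carrier_vec (length s1)" "M2 *\<^sub>v b \<in> carrier_vec (length s1)"
    using C(2) abc by auto
  have carr: "u0 \<in> carrier_vec (length s1)" "u1 \<in> carrier_vec (length s1)"
    using u(1) Ma by (auto simp: u0_def u1_def)
  have "M2 *\<^sub>v w 0 1 = - (indet 0 \<cdot>\<^sub>v (M2 *\<^sub>v b)) - indet 1 \<cdot>\<^sub>v (M2 *\<^sub>v a)"
    unfolding abc(5) using abc(1,2) C(2)
    by (simp add: mult_minus_distrib_mat_vec[OF C(2)] mult_mat_vec_smult[OF C(2)] mult_mat_vec_uminus[OF C(2)])
  then have weq: "indet 0 \<cdot>\<^sub>v u 1 - indet 1 \<cdot>\<^sub>v u 0 = - (indet 0 \<cdot>\<^sub>v (M2 *\<^sub>v b)) - indet 1 \<cdot>\<^sub>v (M2 *\<^sub>v a)"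
    by (simp add: w(2))
  then have eq: "indet 0 * u1 $ k = indet 1 * u0 $ k" if "k < length s1" for k
  proof -
    have "(indet 0 \<cdot>\<^sub>v u 1 - indet 1 \<cdot>\<^sub>v u 0) $ k
        = (- (indet 0 \<cdot>\<^sub>v (M2 *\<^sub>v b)) - indet 1 \<cdot>\<^sub>v (M2 *\<^sub>v a)) $ k"
      by (simp only: weq)
    then have "indet 0 * u 1 $ k - indet 1 * u 0 $ k
        = - (indet 0 * (M2 *\<^sub>v b) $ k) - indet 1 * (M2 *\<^sub>v a) $ k"
      using that carrier_vecD[OF u(1)] carrier_vecD[OF Ma(1)] carrier_vecD[OF Ma(2)]
      by (simp del: index_mult_mat_vec)
    then show ?thesis
      using that carrier_vecD[OF u(1)] carrier_vecD[OF Ma(1)] carrier_vecD[OF Ma(2)]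
      unfolding u0_def u1_def
      by (simp add: algebra_simps eq_diff_eq diff_eq_eq del: index_mult_mat_vec)
  qed
  have "\<exists>g. u0 $ k = indet 0 * g" if "k < length s1" for k
    using koszul2[OF _ eq[OF that]] by auto
  then obtain g where g: "\<And>k. k < length s1 \<Longrightarrow> u0 $ k = indet 0 * g k" by metis
  have u0: "u0 = indet 0 \<cdot>\<^sub>v vec (length s1) g"
    using carr g by (intro eq_vecI) auto
  have "M1 *\<^sub>v u0 = indet 0 \<cdot>\<^sub>v fv"
    unfolding u0_def using u(1) Ma abc(1) C1 fv
    by (simp add: mult_minus_distrib_mat_vec[OF C1] M12 u(2)[symmetric])
  then have "indet 0 \<cdot>\<^sub>v (M1 *\<^sub>v vec (length s1) g) = indet 0 \<cdot>\<^sub>v fv"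
    unfolding u0 by (simp add: mult_mat_vec_smult[OF C1])
  then have "(indet 0 \<cdot>\<^sub>v (M1 *\<^sub>v vec (length s1) g)) $ 0 = (indet 0 \<cdot>\<^sub>v fv) $ 0" by simp
  then have "indet 0 * (M1 *\<^sub>v vec (length s1) g) $ 0 = indet 0 * f"
    using C1 by (simp add: fv_def del: index_mult_mat_vec)
  then have "(M1 *\<^sub>v vec (length s1) g) $ 0 = f" by simp
  moreover have "M1 *\<^sub>v vec (length s1) g \<in> mat_image M1"
    using C1 unfolding mat_image_def by auto
  ultimately have "f \<in> I" unfolding im by simp
  with f show False by simp
qed

section \<open>Dimensions of spaces of forms over the field of constants\<close>

lemma R3_simps [simp]:
  "carrier (R3 :: 'k::field poly3 ring) = UNIV"
  "x \<otimes>\<^bsub>(R3 :: 'k poly3 ring)\<^esub> y = x * y"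
  "x \<oplus>\<^bsub>(R3 :: 'k poly3 ring)\<^esub> y = x + y"
  "\<zero>\<^bsub>(R3 :: 'k poly3 ring)\<^esub> = 0"
  "\<one>\<^bsub>(R3 :: 'k poly3 ring)\<^esub> = 1"
  by (simp_all add: ring_of_type_algebra_def)

lemma cring_R3: "cring (R3 :: 'k::field poly3 ring)"
  by (rule cring_from_type_algebra)

lemma ring_R3: "ring (R3 :: 'k::field poly3 ring)"
  by (rule ring_from_type_algebra)

lemma R3_uminus [simp]: "\<ominus>\<^bsub>R3\<^esub> (x :: 'k::field poly3) = - x"
proof -
  interpret R: ring "R3 :: 'k poly3 ring" by (rule ring_R3)
  show ?thesis by (rule R.minus_equality) auto
qed

text \<open>Dimensions in \<open>HOL-Algebra\<close> are taken over a subfield of the ring itself,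
  so \<open>k\<close> appears as the set of constant polynomials.\<close>

definition coefs :: "'k::field poly3 set"
  where "coefs = range (Poly_Mapping.single 0)"

lemma subfield_coefs: "subfield coefs (R3 :: 'k::field poly3 ring)"
proof -
  interpret R: cring "R3 :: 'k poly3 ring" by (rule cring_R3)
  show ?thesis
  proof (rule R.subfieldI)
    show "subcring coefs (R3 :: 'k poly3 ring)"
    proof (rule R.subcringI'[OF R.subringI])
      show "\<one>\<^bsub>R3\<^esub> \<in> (coefs :: 'k poly3 set)"
        unfolding coefs_def by (rule range_eqI[of _ _ 1]) simp
    qed (auto simp: coefs_def mult_single single_uminus[symmetric] single_add[symmetric])
    have "Poly_Mapping.single 0 a \<in> Units (R3\<lparr>carrier := coefs\<rparr>)" if "a \<noteq> 0" for a :: 'k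
      using that by (auto simp: Units_def coefs_def mult_single intro!: exI[of _ "inverse a"])
    moreover have "0 \<notin> Units (R3\<lparr>carrier := coefs\<rparr> :: 'k poly3 ring)"
      by (auto simp: Units_def)
    ultimately show "Units (R3\<lparr>carrier := coefs\<rparr>) = (coefs - {\<zero>\<^bsub>R3\<^esub>} :: 'k poly3 set)"
      by (auto simp: Units_def coefs_def) (metis single_zero)
  qed
qed

text \<open>The monomials in \<open>S\<close> form a basis: each new monomial is outside the
  previous span and extends it by one line.\<close>

lemma dimension_keys_subset:
  assumes "finite S"
  shows "ring.dimension R3 (card S) coefs {p :: 'k::field poly3. Poly_Mapping.keys p \<subseteq> S}"
proof -
  interpret R: ring "R3 :: 'k poly3 ring" by (rule ring_R3)
  show ?thesis using assms
  proof (induction S rule: finite_induct)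
    case empty
    have "{p :: 'k poly3. Poly_Mapping.keys p \<subseteq> {}} = {\<zero>\<^bsub>R3\<^esub>}"
      by (auto intro!: poly_mapping_eqI simp: in_keys_iff)
    then show ?case using R.zero_dim by (metis card.empty)
  next
    case (insert m S)
    let ?x = "Poly_Mapping.single m 1 :: 'k poly3"
    have "R.line_extension coefs ?x {p. Poly_Mapping.keys p \<subseteq> S}
      = {p. Poly_Mapping.keys p \<subseteq> insert m S}" (is "?L = ?R")
    proof (intro subset_antisym subsetI)
      fix p assume "p \<in> ?L"
      then obtain a q where p: "p = Poly_Mapping.single m a + q" and q: "Poly_Mapping.keys q \<subseteq> S"
        by (auto simp: R.line_extension_mem_iff coefs_def mult_single)
      then show "p \<in> ?R"
        using keys_add[of "Poly_Mapping.single m a" q] by (auto split: if_splits)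
    next
      fix p assume p: "p \<in> ?R"
      have "p = Poly_Mapping.single 0 (Poly_Mapping.lookup p m) * ?x + restr (\<lambda>n. n \<noteq> m) p"
        by (rule poly_mapping_eqI) (auto simp: mult_single lookup_add lookup_restr lookup_single when_def)
      moreover have "Poly_Mapping.keys (restr (\<lambda>n. n \<noteq> m) p) \<subseteq> S"
        using p by (auto simp: keys_restr)
      ultimately show "p \<in> ?L"
        unfolding R.line_extension_mem_iff R3_simps coefs_def by blast
    qed
    moreover have "R.dimension (Suc (card S)) coefs (R.line_extension coefs ?x {p. Poly_Mapping.keys p \<subseteq> S})"
      using insert by (intro R.Suc_dim) auto
    ultimately show ?case using insert by simp
  qed
qed

lemma lookup_le_mon_degree: "Poly_Mapping.lookup m i \<le> mon_degree m"
  unfolding mon_degree_def by (rule member_le_sum) simp_all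

lemma finite_mon_degree: "finite {m. mon_degree m = d}"
proof -
  have "finite (Poly_Mapping.lookup ` {m. mon_degree m = d})"
  proof (rule finite_subset)
    show "Poly_Mapping.lookup ` {m. mon_degree m = d} \<subseteq> {f. \<forall>i. (i \<in> (UNIV :: 3 set) \<longrightarrow> f i \<in> {..d}) \<and> (i \<notin> (UNIV :: 3 set) \<longrightarrow> f i = 0)}"
      by (auto simp: lookup_le_mon_degree)
  qed (intro finite_set_of_finite_funs; simp)
  moreover have "inj_on Poly_Mapping.lookup {m. mon_degree m = d}"
    by (simp add: inj_on_def)
  ultimately show ?thesis by (rule finite_imageD)
qed

lemma forms_eq_keys: "forms (int d) = {p. Poly_Mapping.keys p \<subseteq> {m. mon_degree m = d}}"
  by (auto simp: forms_def)

lemma dimension_forms: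
  "ring.dimension R3 (card {m. mon_degree m = d}) coefs (forms (int d) :: 'k::field poly3 set)"
  unfolding forms_eq_keys by (rule dimension_keys_subset[OF finite_mon_degree])

lemma UNIV_three: "(UNIV :: 3 set) = {0, 1, 2}"
proof -
  have "x = 0 \<or> x = 1 \<or> x = 2" for x :: 3
  proof (induct x)
    case (of_int z)
    then have "z = 0 \<or> z = 1 \<or> z = 2" by fastforce
    then show ?case by auto
  qed
  then show ?thesis by auto
qed

lemma sum_UNIV_three: "sum f (UNIV :: 3 set) = f 0 + f 1 + (f 2 :: nat)"
  unfolding UNIV_three by (simp add: add.assoc)

text \<open>The first two exponents \<open>a\<close> and \<open>b\<close> determine the third, so
  the count is that of the pairs with \<open>a + b \<le> d\<close>.\<close>

lemma card_mon_degree: "card {m. mon_degree m = d} = (\<Sum>a\<le>d. d - a + 1)"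
proof -
  let ?T = "SIGMA a:{..d}. {..d - a}"
  let ?lk = "Poly_Mapping.lookup :: (3 \<Rightarrow>\<^sub>0 nat) \<Rightarrow> 3 \<Rightarrow> nat"
  have deg: "mon_degree m = ?lk m 0 + ?lk m 1 + ?lk m 2" for m
    by (simp add: mon_degree_def sum_UNIV_three)
  have "bij_betw (\<lambda>m. (?lk m 0, ?lk m 1)) {m. mon_degree m = d} ?T"
    unfolding bij_betw_def
  proof (intro conjI subset_antisym subsetI)
    show "inj_on (\<lambda>m. (?lk m 0, ?lk m 1)) {m. mon_degree m = d}"
    proof (rule inj_onI, rule poly_mapping_eqI)
      fix m n :: "3 \<Rightarrow>\<^sub>0 nat" and i :: 3
      assume "m \<in> {m. mon_degree m = d}" "n \<in> {m. mon_degree m = d}" "(?lk m 0, ?lk m 1) = (?lk n 0, ?lk n 1)"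
      moreover have "i \<in> {0, 1, 2}" using UNIV_I[of i] unfolding UNIV_three .
      ultimately show "?lk m i = ?lk n i" by (auto simp: deg)
    qed
    fix x assume "x \<in> ?T"
    then obtain a b where x: "x = (a, b)" and ab: "a + b \<le> d" by auto
    let ?m = "Poly_Mapping.single 0 a + Poly_Mapping.single 1 b + Poly_Mapping.single 2 (d - a - b) :: 3 \<Rightarrow>\<^sub>0 nat"
    have "mon_degree ?m = d" using ab by (simp add: mon_degree_add)
    moreover have "(?lk ?m 0, ?lk ?m 1) = x" by (simp add: x lookup_add lookup_single)
    ultimately show "x \<in> (\<lambda>m. (?lk m 0, ?lk m 1)) ` {m. mon_degree m = d}" by blast
  qed (auto simp: deg)
  then have "card {m. mon_degree m = d} = card ?T" by (rule bij_betw_same_card)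
  then show ?thesis by simp
qed

lemma card_mon_degree_2: "card {m. mon_degree m = 2} = 6"
  and card_mon_degree_3: "card {m. mon_degree m = 3} = 10"
  by (simp_all add: card_mon_degree numeral_eq_Suc)

section \<open>The quotient by a proper homogeneous ideal\<close>

locale proper_homogeneous_ideal =
  fixes I :: "'k::field poly3 set"
  assumes hom: "homogeneous_ideal I" and one_notin: "1 \<notin> I"
begin

sublocale R: cring "R3 :: 'k poly3 ring" by (rule cring_R3)

sublocale Id: ideal I "R3 :: 'k poly3 ring" using hom by (simp add: homogeneous_ideal_def)

abbreviation (input) h :: "'k poly3 \<Rightarrow> 'k poly3 set" where "h p \<equiv> I +>\<^bsub>R3\<^esub> p"

sublocale H: ring_hom_ring R3 "R3 Quot I" h by (rule Id.rcos_ring_hom_ring)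

lemma I_zero: "0 \<in> I" and I_add: "p \<in> I \<Longrightarrow> q \<in> I \<Longrightarrow> p + q \<in> I"
  and I_mult: "p \<in> I \<Longrightarrow> q * p \<in> I"
  using Id.zero_closed Id.a_closed[of p q] Id.I_l_closed[of p q] by auto

lemma I_uminus: "p \<in> I \<Longrightarrow> - p \<in> I"
  using I_mult[of p "-1"] by simp

lemma I_sum: "(\<And>a. a \<in> A \<Longrightarrow> f a \<in> I) \<Longrightarrow> sum f A \<in> I"
  by (induction A rule: infinite_finite_induct) (auto intro: I_zero I_add)

lemma zero_Quot: "\<zero>\<^bsub>R3 Quot I\<^esub> = I"
  by (simp add: FactRing_def)

lemma h_eq_zero: "h p = \<zero>\<^bsub>R3 Quot I\<^esub> \<longleftrightarrow> p \<in> I"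
  using Id.rcos_const_imp_mem[of p] R.a_rcos_zero[OF Id.ideal_axioms, of p] by (auto simp: zero_Quot)

lemma h_eq_iff: "h p = h q \<longleftrightarrow> p - q \<in> I"
proof -
  have "p - q \<in> I \<longleftrightarrow> h (p - q) = \<zero>\<^bsub>R3 Quot I\<^esub>" by (simp add: h_eq_zero)
  also have "h (p - q) = h p \<ominus>\<^bsub>R3 Quot I\<^esub> h q"
    using H.hom_add[of p "- q"] H.hom_a_inv[of q] by (simp add: a_minus_def)
  finally show ?thesis
    using H.S.r_right_minus_eq H.hom_closed by simp
qed

lemma one_not_zero_Quot: "\<one>\<^bsub>R3 Quot I\<^esub> \<noteq> \<zero>\<^bsub>R3 Quot I\<^esub>"
  using h_eq_zero[of 1] one_notin H.hom_one by simp

lemma scalars_eq: "scalars I = h ` coefs"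
  by (auto simp: scalars_def coefs_def)

text \<open>Properness of \<open>I\<close> enters here: since 1 survives in the quotient, the
  constants map onto a subfield, and dimensions over it are well defined.\<close>

lemma subfield_scalars: "subfield (scalars I) (R3 Quot I)"
  unfolding scalars_eq by (rule H.img_is_subfield(2)[OF subfield_coefs one_not_zero_Quot])

text \<open>The polynomials all of whose components lie in \<open>I\<close> form an ideal, and it
  contains the homogeneous generators, so it contains \<open>I\<close>.\<close>

lemma homogeneous_component_mem:
  assumes "p \<in> I"
  shows "hcomp d p \<in> I"
proof -
  obtain S where S: "S \<subseteq> (\<Union>d. forms d)" "I = genideal R3 S"
    using hom by (auto simp: homogeneous_ideal_def)
  let ?J = "{p. \<forall>d. hcomp d p \<in> I}"
  have "ideal ?J R3"
  proof (rule idealI[OF ring_R3])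
    show "subgroup ?J (add_monoid R3)"
    proof (rule R.add.subgroupI)
      show "?J \<noteq> {}" using I_zero by (auto intro!: exI[of _ 0])
      show "\<ominus>\<^bsub>R3\<^esub> a \<in> ?J" if "a \<in> ?J" for a
      proof -
        have "hcomp d (- a) = - hcomp d a" for d
          using restr_diff[of _ 0 a] by simp
        then show ?thesis using that by (simp add: I_uminus)
      qed
    qed (auto simp: restr_add I_add)
    have *: "x * a \<in> ?J" if a: "a \<in> ?J" for a x
    proof -
      have "hcomp d (x * a) \<in> I" for d
      proof -
        \<comment> \<open>Multiplication by a single term shifts all degrees equally, so closure
          under products is checked term by term.\<close>
        have "x * a = (\<Sum>m\<in>Poly_Mapping.keys x. Poly_Mapping.single m (Poly_Mapping.lookup x m) * a)"
          by (subst poly_sum_singles) (rule sum_distrib_right)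
        then have "hcomp d (x * a) = (\<Sum>m\<in>Poly_Mapping.keys x. hcomp d (Poly_Mapping.single m (Poly_Mapping.lookup x m) * a))"
          by (simp add: restr_sum)
        also have "\<dots> \<in> I"
        proof (rule I_sum)
          fix m
          have "hcomp d (Poly_Mapping.single m c * a)
              = Poly_Mapping.single m c * hcomp (d - int (mon_degree m)) a" for c
            using hcomp_mult_form[OF forms_single[OF refl, of m c], of "d - int (mon_degree m)" a] by simp
          then show "hcomp d (Poly_Mapping.single m (Poly_Mapping.lookup x m) * a) \<in> I"
            using a by (simp add: I_mult)
        qed
        finally show ?thesis .
      qed
      then show ?thesis by simp
    qed
    then show "x \<otimes>\<^bsub>R3\<^esub> a \<in> ?J" "a \<otimes>\<^bsub>R3\<^esub> x \<in> ?J" if "a \<in> ?J" "x \<in> carrier R3" for a x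
      using that by (simp_all add: mult.commute)
  qed
  moreover have "S \<subseteq> ?J"
  proof
    fix p assume p: "p \<in> S"
    with S obtain e where e: "p \<in> forms e" by auto
    have "p \<in> I" using p S R.genideal_self by auto
    then show "p \<in> ?J"
      using e I_zero by (auto simp: hcomp_form hcomp_form_other split: if_splits)
        (metis hcomp_form hcomp_form_other)
  qed
  ultimately have "I \<subseteq> ?J" unfolding S(2) by (intro R.genideal_minimal)
  then show ?thesis using assms by auto
qed

end

section \<open>Hilbert function, multiplicity and the artinian condition\<close>

definition low_degree :: "nat \<Rightarrow> 'k::field poly3 set"
  where "low_degree d = {p. \<forall>m\<in>Poly_Mapping.keys p. mon_degree m \<le> d}"

text \<open>This is the power of exponent \<open>d\<close> of the ideal generated by the
  variables.\<close>

definition high_degree :: "nat \<Rightarrow> 'k::field poly3 set"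
  where "high_degree d = {p. \<forall>m\<in>Poly_Mapping.keys p. d \<le> mon_degree m}"

lemma ideal_high_degree: "ideal (high_degree d) (R3 :: 'k::field poly3 ring)"
proof -
  interpret R: cring "R3 :: 'k poly3 ring" by (rule cring_R3)
  show ?thesis
  proof (rule idealI[OF ring_R3])
    show "subgroup (high_degree d) (add_monoid (R3 :: 'k poly3 ring))"
    proof (rule R.add.subgroupI)
      show "high_degree d \<noteq> ({} :: 'k poly3 set)"
        by (auto simp: high_degree_def intro!: exI[of _ 0])
      show "a \<oplus>\<^bsub>R3\<^esub> b \<in> high_degree d" if "a \<in> high_degree d" "b \<in> high_degree d" for a b :: "'k poly3"
        using that keys_add[of a b] by (auto simp: high_degree_def)
    qed (auto simp: high_degree_def in_keys_iff)
    have "x * a \<in> high_degree d" if "a \<in> high_degree d" for a x :: "'k poly3"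
      using that by (fastforce simp: high_degree_def mon_degree_add elim!: keys_multE)
    then show "x \<otimes>\<^bsub>R3\<^esub> a \<in> high_degree d" "a \<otimes>\<^bsub>R3\<^esub> x \<in> high_degree d"
      if "a \<in> high_degree d" "x \<in> carrier R3" for a x :: "'k poly3"
      using that by (simp_all add: mult.commute)
  qed
qed

context proper_homogeneous_ideal
begin

lemma quot_piece_eq: "quot_piece I d = h ` forms (int d)"
  by (simp add: quot_piece_def)

text \<open>Rank and nullity for the quotient map restricted to forms of degree \<open>d\<close>,
  whose kernel is the part of \<open>I\<close> in that degree.\<close>

lemma dimension_ideal_forms:
  obtains m where "R.dimension m coefs (I \<inter> forms (int d))"
    "H.S.dimension (card {m. mon_degree m = d} - m) (scalars I) (quot_piece I d)"
proof -
  have fin: "R.finite_dimension coefs (forms (int d))"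
    using dimension_forms R.finite_dimensionI by blast
  have "subalgebra coefs (I \<inter> forms (int d)) R3"
    by (rule R.subalgebra_inter[OF R.ideal_is_subalgebra[OF _ Id.ideal_axioms]
        R.finite_dimension_imp_subalgebra[OF subfield_coefs fin]]) simp
  then obtain m where m: "R.dimension m coefs (I \<inter> forms (int d))"
    using R.subalbegra_incl_imp_finite_dimension[OF subfield_coefs fin] by auto
  have "a_kernel (R3\<lparr>carrier := forms (int d)\<rparr>) (R3 Quot I) h = I \<inter> forms (int d)"
    by (simp only: a_kernel_def' h_eq_zero) auto
  with m have "R.dimension m coefs (a_kernel (R3\<lparr>carrier := forms (int d)\<rparr>) (R3 Quot I) h)"
    by simp
  from H.rank_nullity_theorem[OF subfield_coefs one_not_zero_Quot dimension_forms this] m that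
  show thesis unfolding scalars_eq quot_piece_eq by blast
qed

text \<open>\<open>ring.dim\<close> is informative only once some number is known to be a dimension;
  this turns \<open>h_vector\<close> into an actual dimension statement.\<close>

lemma dimension_quot_piece: "H.S.dimension (h_vector I d) (scalars I) (quot_piece I d)"
proof -
  obtain n where "H.S.dimension n (scalars I) (quot_piece I d)"
    using dimension_ideal_forms by metis
  moreover from this have "h_vector I d = n"
    unfolding h_vector_def using H.S.dimI[OF subfield_scalars] by (simp add: over_def)
  ultimately show ?thesis by simp
qed

lemma dimension_ideal_forms_h_vector:
  obtains m where "R.dimension m coefs (I \<inter> forms (int d))"
    "card {m. mon_degree m = d} - m = h_vector I d"
  using dimension_ideal_forms[of d] dimension_quot_piece[of d] H.S.dimension_is_inj[OF subfield_scalars]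
  by metis

lemma h_vector_eq_0: "h_vector I d = 0 \<Longrightarrow> forms (int d) \<subseteq> I"
  using dimension_quot_piece[of d] H.S.dimension_zero[OF subfield_scalars, of "quot_piece I d"]
  by (auto simp: quot_piece_eq h_eq_zero[symmetric])

text \<open>Each step adds one graded piece as a direct summand. The sum is direct because
  \<open>I\<close> is homogeneous: if \<open>p - q \<in> I\<close> with \<open>p\<close> of lower
  degree, the top component puts \<open>q\<close> into \<open>I\<close>.\<close>

lemma dimension_low_degree:
  "H.S.dimension (\<Sum>i\<le>d. h_vector I i) (scalars I) (h ` low_degree d)"
proof (induction d)
  case 0
  have "low_degree 0 = (forms (int 0) :: 'k poly3 set)" by (auto simp: low_degree_def forms_def)
  then show ?case using dimension_quot_piece[of 0] by (simp only: quot_piece_eq) simp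
next
  case (Suc d)
  have "h ` low_degree (Suc d) = h ` low_degree d <+>\<^bsub>R3 Quot I\<^esub> quot_piece I (Suc d)" (is "?L = ?R")
  proof (intro subset_antisym subsetI)
    fix x assume "x \<in> ?L"
    then obtain p where p: "x = h p" "p \<in> low_degree (Suc d)" by auto
    let ?q = "restr (\<lambda>m. mon_degree m \<le> d) p" and ?r = "hcomp (int (Suc d)) p"
    have "p = ?q + ?r"
    proof (rule poly_mapping_eqI)
      fix m
      show "Poly_Mapping.lookup p m = Poly_Mapping.lookup (?q + ?r) m"
      proof (cases "m \<in> Poly_Mapping.keys p")
        case True
        with p(2) have "mon_degree m \<le> d \<or> mon_degree m = Suc d" by (auto simp: low_degree_def)
        then show ?thesis by (auto simp: lookup_add lookup_restr)
      qed (simp add: lookup_add lookup_restr in_keys_iff)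
    qed
    then have "x = h ?q \<oplus>\<^bsub>R3 Quot I\<^esub> h ?r"
      unfolding p(1) using H.hom_add[of ?q ?r] by simp
    moreover have "?q \<in> low_degree d" by (auto simp: low_degree_def keys_restr)
    ultimately show "x \<in> ?R"
      using hcomp_in_forms[of "int (Suc d)" p] unfolding quot_piece_eq set_add_def' by blast
  next
    fix x assume "x \<in> ?R"
    then obtain p q where pq: "p \<in> low_degree d" "q \<in> forms (int (Suc d))" "x = h p \<oplus>\<^bsub>R3 Quot I\<^esub> h q"
      unfolding quot_piece_eq set_add_def' by blast
    have "p + q \<in> low_degree (Suc d)"
      using pq(1,2) keys_add[of p q] by (fastforce simp: low_degree_def forms_def)
    moreover have "x = h (p + q)" using H.hom_add[of p q] pq(3) by simp
    ultimately show "x \<in> ?L" by blast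
  qed
  moreover have "h ` low_degree d \<inter> quot_piece I (Suc d) = {\<zero>\<^bsub>R3 Quot I\<^esub>}"
  proof (intro subset_antisym subsetI)
    fix x assume "x \<in> h ` low_degree d \<inter> quot_piece I (Suc d)"
    then obtain p q where pq: "p \<in> low_degree d" "q \<in> forms (int (Suc d))" "x = h p" "x = h q"
      by (auto simp: quot_piece_eq)
    then have "p - q \<in> I" by (simp add: h_eq_iff[symmetric])
    then have "hcomp (int (Suc d)) (p - q) \<in> I" by (rule homogeneous_component_mem)
    moreover have "hcomp (int (Suc d)) p = 0"
      using pq(1) by (intro restr_eq_0) (auto simp: low_degree_def)
    ultimately have "- q \<in> I" using pq(2) by (simp add: restr_diff hcomp_form)
    then have "q \<in> I" using I_uminus by fastforce
    then show "x \<in> {\<zero>\<^bsub>R3 Quot I\<^esub>}" using pq(4) h_eq_zero by simp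
  next
    fix x assume "x \<in> {\<zero>\<^bsub>R3 Quot I\<^esub>}"
    then have "x = h 0" using h_eq_zero[of 0] I_zero by simp
    then show "x \<in> h ` low_degree d \<inter> quot_piece I (Suc d)"
      by (auto simp: quot_piece_eq low_degree_def)
  qed
  ultimately show ?case
    using H.S.dimension_direct_sum_space[OF subfield_scalars Suc.IH dimension_quot_piece[of "Suc d"]]
    by simp
qed

text \<open>The images of the ideals \<open>high_degree n\<close> form a descending chain. Once it
  is stationary, a form of degree \<open>d\<close> agrees modulo \<open>I\<close> with a polynomial
  whose monomials all have larger degree, and the component of degree \<open>d\<close> of the
  difference is the form itself.\<close>

lemma artinian_imp_forms_subset:
  assumes "artinian_ring (R3 Quot I)"
  obtains N where "\<And>d. d \<ge> N \<Longrightarrow> forms (int d) \<subseteq> I"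
proof -
  let ?J = "\<lambda>n. h ` high_degree n"
  have "ideal (?J n) (R3 Quot I)" for n
    by (rule R.ring_ideal_imp_quot_ideal[OF Id.ideal_axioms ideal_high_degree])
  moreover have "?J (Suc n) \<subseteq> ?J n" for n
    by (intro image_mono) (auto simp: high_degree_def)
  ultimately obtain N where N: "\<And>n. n \<ge> N \<Longrightarrow> ?J n = ?J N"
    using assms[unfolded artinian_ring_def, THEN conjunct2, THEN spec[of _ ?J]] by auto
  show thesis
  proof (rule that)
    fix d assume "d \<ge> N"
    show "forms (int d) \<subseteq> I"
    proof
      fix p :: "'k poly3" assume p: "p \<in> forms (int d)"
      then have "h p \<in> ?J d" by (auto simp: forms_def high_degree_def)
      also have "?J d = ?J (Suc d)" using N \<open>d \<ge> N\<close> by (metis le_SucI)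
      finally obtain q where q: "q \<in> high_degree (Suc d)" "p - q \<in> I" by (auto simp: h_eq_iff)
      have "hcomp (int d) q = 0" using q(1) by (intro restr_eq_0) (auto simp: high_degree_def)
      with homogeneous_component_mem[OF q(2), of "int d"] p show "p \<in> I"
        by (simp add: restr_diff hcomp_form del: of_nat_eq_iff)
    qed
  qed
qed

lemma multiplicity_quot_eq_sum:
  assumes N: "\<And>d. d \<ge> N \<Longrightarrow> forms (int d) \<subseteq> I"
  shows "multiplicity_quot I = (\<Sum>i\<le>N. h_vector I i)"
proof -
  have "carrier (R3 Quot I) = range h"
    by (auto simp: FactRing_def A_RCOSETS_def')
  also have "\<dots> \<subseteq> h ` low_degree N"
  proof
    fix x assume "x \<in> range h"
    then obtain p where x: "x = h p" by auto
    let ?q = "restr (\<lambda>m. mon_degree m \<le> N) p" and ?r = "restr (\<lambda>m. \<not> mon_degree m \<le> N) p"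
    have "?r \<in> I"
    proof (subst poly_sum_singles, rule I_sum)
      fix m assume "m \<in> Poly_Mapping.keys ?r"
      then have "N \<le> mon_degree m" by (auto simp: keys_restr)
      then show "Poly_Mapping.single m (Poly_Mapping.lookup ?r m) \<in> I"
        using N[of "mon_degree m"] forms_single[OF refl] by blast
    qed
    moreover have "p - ?q = ?r" using restr_split[of "\<lambda>m. mon_degree m \<le> N" p] by (simp add: algebra_simps)
    ultimately have "x = h ?q" by (simp add: x h_eq_iff)
    then show "x \<in> h ` low_degree N" by (auto simp: low_degree_def keys_restr)
  qed
  finally have "carrier (R3 Quot I) = h ` low_degree N" using H.hom_closed by auto
  then have "H.S.dimension (\<Sum>i\<le>N. h_vector I i) (scalars I) (carrier (R3 Quot I))"
    using dimension_low_degree by simp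
  then show ?thesis
    unfolding multiplicity_quot_def using H.S.dimI[OF subfield_scalars] by (simp add: over_def)
qed

lemma multiplicity_lower_bound:
  assumes "artinian_ring (R3 Quot I)" "h_vector I 0 = 1" "h_vector I 1 = 3"
  obtains c where "\<not> forms (int c) \<subseteq> I" "forms (int (Suc c)) \<subseteq> I" "c + 3 \<le> multiplicity_quot I"
proof -
  obtain N where N: "\<And>d. d \<ge> N \<Longrightarrow> forms (int d) \<subseteq> I"
    using artinian_imp_forms_subset assms(1) by blast
  \<comment> \<open>With the least such degree, all pieces below \<open>n\<close> are nonzero by
    definition; \<open>c\<close> will be \<open>n - 1\<close>.\<close>
  define n where "n = (LEAST n. forms (int n) \<subseteq> I)"
  have n: "forms (int n) \<subseteq> I" unfolding n_def by (rule LeastI[of _ N]) (simp add: N)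
  have least: "\<not> forms (int i) \<subseteq> I" if "i < n" for i
    using that unfolding n_def by (rule not_less_Least)
  have "n \<le> N" unfolding n_def by (rule Least_le) (simp add: N)
  have sub0: "h_vector I d = 0" if "forms (int d) \<subseteq> I" for d
  proof -
    have "quot_piece I d = {\<zero>\<^bsub>R3 Quot I\<^esub>}"
      using that h_eq_zero I_zero zero_in_forms unfolding quot_piece_eq by blast
    then show ?thesis
      using H.S.dimension_is_inj[OF subfield_scalars dimension_quot_piece[of d]] H.S.dimension.intros(1)[of "scalars I"]
      by simp
  qed
  have "n \<noteq> 0" "n \<noteq> 1" using sub0[OF n] assms(2,3) by (metis zero_neq_one, metis zero_neq_numeral)
  then have n2: "n \<ge> 2" by linarith
  \<comment> \<open>Here \<open>n + 2 = 1 + 3 + (n - 2)\<close>: degrees 0 and 1 count in full,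
    every later degree below \<open>n\<close> counts once.\<close>
  have "n + 2 = (\<Sum>i<2. h_vector I i) + (\<Sum>i=2..<n. 1)"
    using n2 assms(2,3) by (simp add: numeral_2_eq_2 lessThan_Suc)
  also have "(\<Sum>i=2..<n. 1) \<le> (\<Sum>i=2..<n. h_vector I i)"
  proof (rule sum_mono)
    fix i assume "i \<in> {2..<n}"
    then show "1 \<le> h_vector I i" using least[of i] h_vector_eq_0[of i] by (cases "h_vector I i") auto
  qed
  also have "(\<Sum>i<2. h_vector I i) + \<dots> = (\<Sum>i<n. h_vector I i)"
    using n2 by (simp add: lessThan_atLeast0 sum.atLeastLessThan_concat)
  also have "\<dots> \<le> (\<Sum>i\<le>N. h_vector I i)"
    using \<open>n \<le> N\<close> by (intro sum_mono2) auto
  also have "\<dots> = multiplicity_quot I" using multiplicity_quot_eq_sum N by metis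
  finally have "n + 2 \<le> multiplicity_quot I" by simp
  then show thesis
    using n2 n least[of "n - 1"] by (intro that[of "n - 1"]) auto
qed

end

section \<open>The linear relation between two quadrics, and the shifts that it and minimality
  force\<close>

lemma lookup_const_mult: "Poly_Mapping.lookup (Poly_Mapping.single 0 c * p) m = c * Poly_Mapping.lookup p m"
  for c :: "'k::field"
proof -
  have "Poly_Mapping.lookup (\<Sum>n\<in>Poly_Mapping.keys p. Poly_Mapping.single 0 c * Poly_Mapping.single n (Poly_Mapping.lookup p n)) m
      = c * Poly_Mapping.lookup p m"
    by (auto simp: lookup_sum mult_single lookup_single when_def in_keys_iff)
  then show ?thesis
    by (simp only: sum_distrib_left[symmetric] poly_sum_singles[symmetric])
qed

lemma lookup_indet: "Poly_Mapping.lookup (indet i) (Poly_Mapping.single j 1) = (if i = j then 1 else 0)"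
proof -
  have "Poly_Mapping.single i (1::nat) = Poly_Mapping.single j 1 \<longleftrightarrow> i = j"
    using lookup_single_eq[of i "1::nat"] lookup_single_not_eq[of j i "1::nat"] by (metis one_neq_zero)
  then show ?thesis by (simp add: indet_def lookup_single when_def)
qed

definition linear_form :: "'k \<Rightarrow> 'k \<Rightarrow> 'k \<Rightarrow> 'k::field poly3"
  where "linear_form a b c = Poly_Mapping.single 0 a * indet 0 + Poly_Mapping.single 0 b * indet 1
    + Poly_Mapping.single 0 c * indet 2"

lemma const_in_forms: "Poly_Mapping.single 0 a \<in> forms 0"
  by (rule forms_single) simp

lemma linear_form_in_forms: "linear_form a b c \<in> forms 1"
  unfolding linear_form_def
  by (intro forms_add) (use forms_mult[OF const_in_forms indet_in_forms] in simp_all)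

lemma linear_form_eq_0: "linear_form a b c = 0 \<longleftrightarrow> a = 0 \<and> b = 0 \<and> c = 0"
proof
  assume "linear_form a b c = 0"
  then have "Poly_Mapping.lookup (linear_form a b c) (Poly_Mapping.single j 1) = 0" for j by simp
  from this[of 0] this[of 1] this[of 2] show "a = 0 \<and> b = 0 \<and> c = 0"
    unfolding linear_form_def lookup_add lookup_const_mult lookup_indet by simp
qed (simp add: linear_form_def)

lemma forms_zero_const: "p \<in> forms 0 \<Longrightarrow> \<exists>a. p = Poly_Mapping.single 0 a"
  by (intro exI[of _ "Poly_Mapping.lookup p 0"] poly_mapping_eqI)
    (auto simp: forms_def mon_degree_eq_0_iff in_keys_iff lookup_single when_def)

lemma (in proper_homogeneous_ideal) linear_syzygy:
  assumes "h_vector I 2 = 4" "h_vector I 3 = 5"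
  obtains f g l l' where "f \<in> I" "g \<in> I" "f \<in> forms 2" "g \<in> forms 2"
    "\<And>a b. Poly_Mapping.single 0 a * f + Poly_Mapping.single 0 b * g = 0 \<Longrightarrow> a = 0 \<and> b = 0"
    "l \<in> forms 1" "l' \<in> forms 1" "l \<noteq> 0 \<or> l' \<noteq> 0" "l * f + l' * g = 0"
proof -
  obtain m where m: "R.dimension m coefs (I \<inter> forms (int 2))" "6 - m = 4"
    using dimension_ideal_forms_h_vector[of 2] assms(1) card_mon_degree_2 by metis
  \<comment> \<open>The subtraction is truncated, but its value 4 is positive and so determines
    \<open>m\<close>. The same applies to \<open>10 - n = 5\<close> in degree 3.\<close>
  then have "R.dimension 2 coefs (I \<inter> forms 2)" by (cases "m = 2") auto
  from R.exists_base[OF subfield_coefs this] obtain Vs where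
    Vs: "R.independent coefs Vs" "length Vs = 2" "R.Span coefs Vs = I \<inter> forms 2"
    by blast
  then obtain f g where fg: "Vs = [f, g]"
    by (auto simp: numeral_2_eq_2 length_Suc_conv)
  have "set Vs \<subseteq> I \<inter> forms 2"
    using R.Span_base_incl[OF subfield_coefs, of Vs] Vs(3) by simp
  then have I: "f \<in> I" "g \<in> I" "f \<in> forms 2" "g \<in> forms 2" by (auto simp: fg)
  have ind: "a = 0 \<and> b = 0" if "Poly_Mapping.single 0 a * f + Poly_Mapping.single 0 b * g = 0" for a b
  proof -
    have "set (take (length Vs) [Poly_Mapping.single 0 a, Poly_Mapping.single 0 b]) \<subseteq> {\<zero>\<^bsub>R3\<^esub>}"
      by (rule R.independent_imp_trivial_combine[OF subfield_coefs Vs(1)])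
        (use that in \<open>auto simp: fg coefs_def\<close>)
    then show ?thesis by (simp add: fg) (metis lookup_single_eq lookup_zero)
  qed
  obtain n where n: "R.dimension n coefs (I \<inter> forms (int 3))" "10 - n = 5"
    using dimension_ideal_forms_h_vector[of 3] assms(2) card_mon_degree_3 by metis
  then have dim3: "R.dimension 5 coefs (I \<inter> forms 3)" by (cases "n = 5") auto
  let ?Ps = "[indet 0 * f, indet 1 * f, indet 2 * f, indet 0 * g, indet 1 * g, indet 2 * g]"
  have "indet i * f \<in> I \<inter> forms 3" "indet i * g \<in> I \<inter> forms 3" for i
    using forms_mult[OF indet_in_forms[of i] I(3)] forms_mult[OF indet_in_forms[of i] I(4)] I(1,2)
    by (auto intro: I_mult)
  then have "set ?Ps \<subseteq> I \<inter> forms 3" by simp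
  then have "R.dependent coefs ?Ps"
    using R.independent_length_le_dimension[OF subfield_coefs dim3, of ?Ps] by auto
  from R.dependent_imp_non_trivial_combine[OF subfield_coefs _ this] obtain Ks where
    Ks: "length Ks = length ?Ps" "R.combine Ks ?Ps = 0" "set Ks \<subseteq> coefs" "set Ks \<noteq> {0}"
    by auto
  from Ks(1) obtain k0 k1 k2 k3 k4 k5 where K: "Ks = [k0, k1, k2, k3, k4, k5]"
    by (auto simp: length_Suc_conv numeral_eq_Suc)
  from Ks(3) obtain c0 c1 c2 c3 c4 c5 where c:
    "k0 = Poly_Mapping.single 0 c0" "k1 = Poly_Mapping.single 0 c1" "k2 = Poly_Mapping.single 0 c2"
    "k3 = Poly_Mapping.single 0 c3" "k4 = Poly_Mapping.single 0 c4" "k5 = Poly_Mapping.single 0 c5"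
    by (auto simp: K coefs_def)
  have "linear_form c0 c1 c2 * f + linear_form c3 c4 c5 * g = 0"
    using Ks(2) by (simp add: K c linear_form_def algebra_simps)
  moreover have "linear_form c0 c1 c2 \<noteq> 0 \<or> linear_form c3 c4 c5 \<noteq> 0"
    using Ks(4) by (auto simp: K c linear_form_eq_0)
  ultimately show thesis
    by (intro that[OF I ind linear_form_in_forms linear_form_in_forms])
qed

text \<open>A zero column would put a unit vector into the kernel of \<open>M\<close>, hence into
  the image of \<open>N\<close>, where minimality forbids the constant entry 1.\<close>

lemma minimal_column_nonzero:
  fixes M :: "'k::field poly3 mat"
  assumes M: "graded_map s t M" and N: "mat_image N = mat_kernel M" "mat_image N \<subseteq> max_times_free (length s)"
    and b: "b < length s"
  obtains a where "a < length t" "M $$ (a, b) \<noteq> 0"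
proof (rule ccontr)
  assume "\<not> thesis"
  with that have zero: "M $$ (a, b) = 0" if "a < length t" for a using that by blast
  note C = graded_map_carrier[OF M]
  have "M *\<^sub>v unit_vec (length s) b = 0\<^sub>v (length t)"
    using C b zero by (intro eq_vecI) auto
  then have "(unit_vec (length s) b :: 'k poly3 vec) \<in> mat_image N"
    using C by (simp add: N(1) mat_kernel_iff)
  with N(2) have "(unit_vec (length s) b :: 'k poly3 vec) \<in> max_times_free (length s)"
    by (rule subsetD)
  then show False using b by (auto simp: max_times_free_def)
qed

text \<open>A nonzero entry in column \<open>b\<close> is a form of degree
  \<open>s ! b - t ! a\<close>, which therefore cannot be negative.\<close>

lemma minimal_shift_ge:
  fixes M :: "'k::field poly3 mat"
  assumes M: "graded_map s t M" and N: "mat_image N = mat_kernel M" "mat_image N \<subseteq> max_times_free (length s)"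
    and b: "b < length s"
  shows "\<exists>a<length t. t ! a \<le> s ! b"
proof -
  obtain a where a: "a < length t" "M $$ (a, b) \<noteq> 0"
    using minimal_column_nonzero[OF assms] .
  moreover have "M $$ (a, b) \<in> forms (s ! b - t ! a)" using M a b by (auto simp: graded_map_def)
  ultimately show ?thesis using forms_neg by (metis diff_less_0_iff_less not_le)
qed

text \<open>By minimality each column of \<open>M1\<close> is a nonzero form in \<open>I\<close>.
  Degree 0 would make it a unit, and degree 1 is excluded by the hypothesis on linear forms.\<close>

lemma generator_degree_ge_2:
  fixes M1 :: "'k::field poly3 mat"
  assumes res: "minimal_graded_free_resolution I s1 s2 s3 M1 M2 M3"
    and I: "I \<inter> forms 1 = {0}" "1 \<notin> I" "\<And>p q. p \<in> I \<Longrightarrow> q * p \<in> I"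
    and b: "b < length s1"
  shows "s1 ! b \<ge> 2"
proof -
  note R = res[unfolded minimal_graded_free_resolution_def]
  have G: "graded_map s1 [0] M1" and im: "mat_image M1 = {v \<in> carrier_vec 1. v $ 0 \<in> I}"
    using R by auto
  have C: "M1 \<in> carrier_mat 1 (length s1)" using graded_map_carrier[OF G] by simp
  obtain a where "a < length [0::int]" "M1 $$ (a, b) \<noteq> 0"
    using minimal_column_nonzero[OF G, of M2 b] R b by blast
  then have nz: "M1 $$ (0, b) \<noteq> 0" by simp
  have deg: "M1 $$ (0, b) \<in> forms (s1 ! b)" using G b by (auto simp: graded_map_def)
  have "M1 *\<^sub>v unit_vec (length s1) b \<in> mat_image M1" using C by (auto simp: mat_image_def)
  then have mem: "M1 $$ (0, b) \<in> I" using C b by (simp add: im)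
  have "s1 ! b \<noteq> 1"
  proof
    assume "s1 ! b = 1"
    with deg mem have "M1 $$ (0, b) \<in> I \<inter> forms 1" by simp
    with nz show False unfolding I(1) by simp
  qed
  moreover have "s1 ! b \<noteq> 0"
  proof
    assume "s1 ! b = 0"
    then obtain a where a: "M1 $$ (0, b) = Poly_Mapping.single 0 a" using deg forms_zero_const by auto
    with nz have "a \<noteq> 0" by auto
    then have "Poly_Mapping.single 0 (inverse a) * M1 $$ (0, b) = 1" by (simp add: a mult_single)
    then show False using I(3)[OF mem, of "Poly_Mapping.single 0 (inverse a)"] I(2) by simp
  qed
  moreover have "s1 ! b \<ge> 0" using forms_neg[OF deg] nz by force
  ultimately show ?thesis by linarith
qed

lemma lift_generator:
  fixes f :: "'k::field poly3"
  assumes res: "minimal_graded_free_resolution I s1 s2 s3 M1 M2 M3"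
    and f: "f \<in> I" "f \<in> forms d"
  shows "\<exists>u \<in> carrier_vec (length s1). M1 *\<^sub>v u = vec 1 (\<lambda>_. f) \<and>
    (\<forall>a < length s1. u $ a \<in> forms (d - s1 ! a))"
proof -
  note R = res[unfolded minimal_graded_free_resolution_def]
  have G: "graded_map s1 [0] M1" and im: "mat_image M1 = {v \<in> carrier_vec 1. v $ 0 \<in> I}"
    using R by auto
  have "vec 1 (\<lambda>_. f) \<in> mat_image M1" using f by (simp add: im)
  then show ?thesis
    using f(2) by (elim graded_lift[OF G, where d = d]) auto
qed

text \<open>The relation lifts to the cycle \<open>l u + l' v\<close> of degree 3 in
  \<open>F_1\<close>. Without a shift at most 3 in \<open>F_2\<close> this cycle is 0, so
  \<open>u\<close> and \<open>v\<close> are proportional, against the independence of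
  \<open>f\<close> and \<open>g\<close>.\<close>

lemma linear_syzygy_shift:
  fixes f g :: "'k::field poly3"
  assumes res: "minimal_graded_free_resolution I s1 s2 s3 M1 M2 M3"
    and ge2: "\<And>a. a < length s1 \<Longrightarrow> s1 ! a \<ge> 2"
    and fg: "f \<in> I" "g \<in> I" "f \<in> forms 2" "g \<in> forms 2"
    and ind: "\<And>a b. Poly_Mapping.single 0 a * f + Poly_Mapping.single 0 b * g = 0 \<Longrightarrow> a = 0 \<and> b = 0"
    and l: "l \<in> forms 1" "l' \<in> forms 1" "l \<noteq> 0 \<or> l' \<noteq> 0" "l * f + l' * g = 0"
  shows "\<exists>b<length s2. s2 ! b \<le> 3"
proof (rule ccontr)
  assume neg: "\<not> ?thesis"
  note R = res[unfolded minimal_graded_free_resolution_def]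
  have G: "graded_map s1 [0] M1" "graded_map s2 s1 M2" and ex: "mat_image M2 = mat_kernel M1"
    using R by auto
  have C: "M1 \<in> carrier_mat (Suc 0) (length s1)" "M2 \<in> carrier_mat (length s1) (length s2)"
    using G[THEN graded_map_carrier] by auto
  obtain u where u: "u \<in> carrier_vec (length s1)" "M1 *\<^sub>v u = vec 1 (\<lambda>_. f)"
    "\<And>a. a < length s1 \<Longrightarrow> u $ a \<in> forms (2 - s1 ! a)"
    using lift_generator[OF res fg(1,3)] by blast
  obtain v where v: "v \<in> carrier_vec (length s1)" "M1 *\<^sub>v v = vec 1 (\<lambda>_. g)"
    "\<And>a. a < length s1 \<Longrightarrow> v $ a \<in> forms (2 - s1 ! a)"
    using lift_generator[OF res fg(2,4)] by blast
  \<comment> \<open>The degree \<open>2 - s1 ! a\<close> is 0 or negative, so such a form is a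
    constant, possibly 0.\<close>
  have const: "\<exists>c. p = Poly_Mapping.single 0 c" if "p \<in> forms (2 - s1 ! a)" "a < length s1" for a and p :: "'k poly3"
  proof (cases "s1 ! a = 2")
    case True
    then show ?thesis using that forms_zero_const by simp
  next
    case False
    then have "p = 0" using ge2[OF that(2)] forms_neg[OF that(1)] by simp
    then show ?thesis by (intro exI[of _ 0]) simp
  qed
  let ?z = "l \<cdot>\<^sub>v u + l' \<cdot>\<^sub>v v"
  have "M1 *\<^sub>v ?z = l \<cdot>\<^sub>v (M1 *\<^sub>v u) + l' \<cdot>\<^sub>v (M1 *\<^sub>v v)"
    using u(1) v(1) by (simp add: mult_add_distrib_mat_vec[OF C(1)] mult_mat_vec_smult[OF C(1)])
  also have "\<dots> = 0\<^sub>v (length [0::int])"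
    unfolding u(2) v(2) using l(4) by (intro eq_vecI) auto
  finally have "M1 *\<^sub>v ?z = 0\<^sub>v (length [0::int])" .
  moreover have "?z $ a \<in> forms (3 - s1 ! a)" if "a < length s1" for a
    using that forms_add[OF forms_mult[OF l(1) u(3)[OF that]] forms_mult[OF l(2) v(3)[OF that]]] u(1) v(1)
    by (simp add: algebra_simps)
  moreover have "?z \<in> carrier_vec (length s1)" using u(1) v(1) by simp
  ultimately obtain w where w: "w \<in> carrier_vec (length s2)" "?z = M2 *\<^sub>v w"
    "\<And>b. b < length s2 \<Longrightarrow> w $ b \<in> forms (3 - s2 ! b)"
    using graded_lift_kernel[OF G ex, of ?z 3] by metis
  have "w = 0\<^sub>v (length s2)"
    using w(1) neg forms_neg[OF w(3)] by (intro eq_vecI) (auto simp: not_le)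
  then have "?z = 0\<^sub>v (length s1)" using w(2) C(2) by auto
  then have "?z $ a = 0" if "a < length s1" for a using that by simp
  then have rel: "l * u $ a = - (l' * v $ a)" if "a < length s1" for a
    using that u(1) v(1) by (simp add: eq_neg_iff_add_eq_0)
  \<comment> \<open>Multiplied by \<open>l\<close> or by \<open>l'\<close>, each 2 by 2 minor of the
    pair \<open>u\<close>, \<open>v\<close> vanishes. One of the two forms is nonzero, and
    polynomials have no zero divisors.\<close>
  have minors: "v $ a * u $ b = u $ a * v $ b" if "a < length s1" "b < length s1" for a b
  proof -
    have "l * (v $ a * u $ b - u $ a * v $ b) = v $ a * (l * u $ b) - (l * u $ a) * v $ b"
      by (simp add: algebra_simps)
    also have "\<dots> = 0" using that by (simp add: rel algebra_simps)
    finally have 1: "l * (v $ a * u $ b - u $ a * v $ b) = 0" .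
    have "l' * (v $ a * u $ b - u $ a * v $ b) = (l' * v $ a) * u $ b - u $ a * (l' * v $ b)"
      by (simp add: algebra_simps)
    also have "\<dots> = - (l * u $ a) * u $ b + u $ a * (l * u $ b)" using that by (simp add: rel)
    also have "\<dots> = 0" by (simp add: algebra_simps)
    finally show ?thesis using 1 l(3) by auto
  qed
  \<comment> \<open>Applying \<open>M1\<close> to the proportionality \<open>v_a u = u_a v\<close>
    gives \<open>v_a f = u_a g\<close> with constant coefficients, so independence makes both of
    them 0.\<close>
  have "u $ a = 0" if a: "a < length s1" for a
  proof -
    have "v $ a \<cdot>\<^sub>v u = u $ a \<cdot>\<^sub>v v"
      using u(1) v(1) minors[OF a] by (intro eq_vecI) auto
    then have "v $ a \<cdot>\<^sub>v (M1 *\<^sub>v u) = u $ a \<cdot>\<^sub>v (M1 *\<^sub>v v)"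
      using mult_mat_vec_smult[OF C(1)] u(1) v(1) by metis
    then have "(v $ a \<cdot>\<^sub>v (M1 *\<^sub>v u)) $ 0 = (u $ a \<cdot>\<^sub>v (M1 *\<^sub>v v)) $ 0" by simp
    then have eq: "v $ a * f = u $ a * g" by (simp add: u(2) v(2))
    obtain c c' where c: "u $ a = Poly_Mapping.single 0 c" "v $ a = Poly_Mapping.single 0 c'"
      using const[OF u(3)[OF a] a] const[OF v(3)[OF a] a] by blast
    have "Poly_Mapping.single 0 c' * f + Poly_Mapping.single 0 (- c) * g = 0"
      using eq by (simp add: c single_uminus)
    then show ?thesis using ind c by force
  qed
  then have "u = 0\<^sub>v (length s1)" using u(1) by (intro eq_vecI) auto
  then have "M1 *\<^sub>v u = 0\<^sub>v (Suc 0)" by (simp add: mult_mat_vec_zero[OF C(1)])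
  then have "vec 1 (\<lambda>_. f) $ 0 = 0\<^sub>v (Suc 0) $ 0" by (simp only: u(2))
  then have "f = 0" by simp
  with ind[of 1 0] show False by simp
qed

theorem proposition3p6:
  fixes I :: "'k::field_char_0 poly3 set"
    and s1 s2 s3 :: "int list"
    and M1 M2 M3 :: "'k poly3 mat"
  assumes "homogeneous_ideal I"
    and "I \<inter> forms 1 = {0}"
    and "artinian_ring (R3 Quot I)"
    and "h_vector I 0 = 1" and "h_vector I 1 = 3" and "h_vector I 2 = 4" and "h_vector I 3 = 5"
    and "minimal_graded_free_resolution I s1 s2 s3 M1 M2 M3"
  shows "real_of_int (min_shift s1 * min_shift s2 * min_shift s3) / 6
    \<le> real (multiplicity_quot I)"
proof -
  have "ideal I R3" using assms(1) by (simp add: homogeneous_ideal_def)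
  \<comment> \<open>If 1 were in \<open>I\<close>, so would be the nonzero linear form
    \<open>indet 0\<close>.\<close>
  then have "indet 0 \<in> I" if "1 \<in> I" using ideal.I_l_closed[of I R3 1 "indet 0"] that by simp
  then have "1 \<notin> I" using assms(2) indet_in_forms[of 0] indet_nonzero[of 0] by blast
  then interpret proper_homogeneous_ideal I using assms(1) by unfold_locales
  note res = assms(8)
  note R = res[unfolded minimal_graded_free_resolution_def]
  have s1_ge: "s1 ! a \<ge> 2" if "a < length s1" for a
    using generator_degree_ge_2[OF res assms(2) one_notin I_mult that] .
  \<comment> \<open>This lower bound makes the product of the first two minimal shifts nonnegative,
    as required for multiplying it with the bound on the third.\<close>
  have s2_ge: "s2 ! b \<ge> 2" if "b < length s2" for b
  proof -
    have "\<exists>a<length s1. s1 ! a \<le> s2 ! b"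
      using minimal_shift_ge[of s2 s1 M2 M3 b] R that by blast
    then show ?thesis using s1_ge by force
  qed
  obtain f g l l' where syz: "f \<in> I" "g \<in> I" "f \<in> forms 2" "g \<in> forms 2"
    "\<And>a b. Poly_Mapping.single 0 a * f + Poly_Mapping.single 0 b * g = 0 \<Longrightarrow> a = 0 \<and> b = 0"
    "l \<in> forms 1" "l' \<in> forms 1" "l \<noteq> 0 \<or> l' \<noteq> 0" "l * f + l' * g = 0"
    using linear_syzygy[OF assms(6,7)] by blast
  obtain b2 where b2: "b2 < length s2" "s2 ! b2 \<le> 3"
    using linear_syzygy_shift[OF res s1_ge syz] by blast
  \<comment> \<open>If all generators had degree above 2, the quadric \<open>f\<close> would lift to
    entries of negative degree and vanish.\<close>
  have "\<exists>a<length s1. s1 ! a \<le> 2"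
  proof (rule ccontr)
    assume neg: "\<not> ?thesis"
    obtain u where u: "u \<in> carrier_vec (length s1)" "M1 *\<^sub>v u = vec 1 (\<lambda>_. f)"
      "\<And>a. a < length s1 \<Longrightarrow> u $ a \<in> forms (2 - s1 ! a)"
      using lift_generator[OF res syz(1,3)] by blast
    have "u = 0\<^sub>v (length s1)"
      using u(1) neg forms_neg[OF u(3)] by (intro eq_vecI) (auto simp: not_le)
    moreover have "M1 \<in> carrier_mat (Suc 0) (length s1)" using R graded_map_carrier by fastforce
    ultimately have "M1 *\<^sub>v u = 0\<^sub>v (Suc 0)" by (simp add: mult_mat_vec_zero)
    then have "vec 1 (\<lambda>_. f) $ 0 = 0\<^sub>v (Suc 0) $ 0" by (simp only: u(2))
    then have "f = 0" by simp
    with syz(5)[of 1 0] show False by simp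
  qed
  then obtain b1 where b1: "b1 < length s1" "s1 ! b1 \<le> 2" by blast
  obtain c where c: "\<not> forms (int c) \<subseteq> I" "forms (int (Suc c)) \<subseteq> I" "c + 3 \<le> multiplicity_quot I"
    using multiplicity_lower_bound[OF assms(3-5)] .
  then obtain p where p: "p \<in> forms (int c)" "p \<notin> I" by blast
  have "indet i * p \<in> I" for i
    using forms_mult[OF indet_in_forms[of i] p(1)] c(2) by (auto simp: add.commute)
  then obtain b3 where b3: "b3 < length s3" "s3 ! b3 \<le> int c + 3"
    using socle_shift[OF res p] by blast
  have le: "min_shift s \<le> s ! b" if "b < length s" for s b
    using that by (simp add: min_shift_def)
  \<comment> \<open>The index \<open>b\<close> ensures that the list is nonempty, so that
    \<open>Min\<close> is attained.\<close>
  have mem: "min_shift s \<in> set s" if "b < length s" for s b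
    unfolding min_shift_def using that by (intro Min_in) auto
  have m1: "min_shift s1 = 2"
    using le[OF b1(1)] b1(2) mem[OF b1(1)] s1_ge by (force simp: in_set_conv_nth)
  have m2: "2 \<le> min_shift s2" "min_shift s2 \<le> 3"
    using le[OF b2(1)] b2(2) mem[OF b2(1)] s2_ge by (force simp: in_set_conv_nth)+
  have "min_shift s1 * min_shift s2 * min_shift s3 \<le> min_shift s1 * min_shift s2 * (int c + 3)"
    using le[OF b3(1)] b3(2) m1 m2 by (intro mult_left_mono) auto
  moreover have "min_shift s1 * min_shift s2 * (int c + 3) \<le> 6 * (int c + 3)"
    using m1 m2 by (intro mult_right_mono) auto
  ultimately have "min_shift s1 * min_shift s2 * min_shift s3 \<le> 6 * (int c + 3)"
    by (rule order.trans)
  moreover have "6 * (int c + 3) \<le> 6 * int (multiplicity_quot I)" using c(3) by simp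
  ultimately have "min_shift s1 * min_shift s2 * min_shift s3 \<le> 6 * int (multiplicity_quot I)"
    by (rule order.trans)
  then have "real_of_int (min_shift s1 * min_shift s2 * min_shift s3)
      \<le> real_of_int (6 * int (multiplicity_quot I))"
    by (rule of_int_le_iff[THEN iffD2])
  then show ?thesis by simp
qed

end
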